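(* Let $S$ be a finitely aligned $k$-monoid each of whose alphabets is finite and has cardinality at least $2$. Then the group of units of $\mathsf{C}(S)=\mathsf{R}(S)/{\equiv}$ is isomorphic to the group $\mathscr{G}(S)=\mathsf{R}(S)^e/\sigma$.
   Context: A $k$-monoid ($k\ge1$) is a countable monoid $S$ with a monoid homomorphism $d\colon S\to\mathbb{N}^k$ such that whenever $d(x)=\mathbf{m}+\mathbf{n}$ there are unique $x_1,x_2\in S$ with $x=x_1x_2$, $d(x_1)=\mathbf{m}$, $d(x_2)=\mathbf{n}$. Its alphabets are $X_i=d^{-1}(\mathbf{e}_i)$, $1\le i\le k$. $S$ is finitely aligned if for all $a,b\in S$ the right ideal $aS\cap bS$ is empty or finitely generated. $\mathsf{R}(S)$ is the inverse monoid, under composition of partial functions, of all bijective morphisms $\alpha\colon XS\to YS$ between finitely generated right ideals of $S$ ($X,Y$ finite, the empty ideal and empty function included), where a morphism satisfies $\alpha(as)=\alpha(a)s$ for all $a\in XS$, $s\in S$. The natural partial order on $\mathsf{R}(S)$ is restriction of partial functions, the zero is the empty function, and any two elements have a meet $\wedge$. The congruence $\equiv$ on an inverse semigroup with zero and binary meets: $s\equiv t$ iff for each $0<x\le s$ we have $x\wedge t\neq0$ and for each $0<y\le t$ we have $y\wedge s\neq 0$. In an inverse semigroup $T$ with zero, a non-zero idempotent $e$ is essential if $ef\neq 0$ for every non-zero idempotent $f$; $T^e$ is the inverse subsemigroup of all $s\in T$ with $s^{-1}s$ and $ss^{-1}$ essential. $\sigma$ is the minimum group congruence: $s\,\sigma\,t$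 iff there is $u\le s,t$. *)

theory Defs
  imports
    "HOL-Library.Countable_Set"
    "HOL-Analysis.Finite_Cartesian_Product"
    "HOL-Algebra.Lattice"
    "HOL-Algebra.Coset"
begin

section \<open>k-monoids\<close>

text \<open>
  The monoid of degrees is the additive monoid of the type \<^typ>\<open>nat ^ 'k\<close>, so that the number
  of alphabets is \<open>CARD('k) \<ge> 1\<close>; the generator \<open>e\<^sub>i\<close> is \<open>axis i 1\<close>.
\<close>

locale k_monoid = Group.monoid S
  for S :: "('a, 'b) monoid_scheme" (structure) +
  fixes d :: "'a \<Rightarrow> nat ^ 'k::finite"
  assumes countable_carrier: "countable (carrier S)"
    and degree_one: "d \<one> = 0"
    and degree_mult: "\<lbrakk>x \<in> carrier S; y \<in> carrier S\<rbrakk> \<Longrightarrow> d (x \<otimes> y) = d x + d y"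
    and unique_factorization:
      "\<lbrakk>x \<in> carrier S; d x = m + n\<rbrakk> \<Longrightarrow>
        \<exists>!(x1, x2). x1 \<in> carrier S \<and> x2 \<in> carrier S \<and> x = x1 \<otimes> x2 \<and> d x1 = m \<and> d x2 = n"

definition alphabet :: "('a, 'b) monoid_scheme \<Rightarrow> ('a \<Rightarrow> nat ^ 'k::finite) \<Rightarrow> 'k \<Rightarrow> 'a set" where
  "alphabet S d i = {x \<in> carrier S. d x = axis i 1}"

text \<open>The empty set counts as a finitely generated right ideal (generated by the empty set).\<close>

definition fg_right_ideal :: "('a, 'b) monoid_scheme \<Rightarrow> 'a set \<Rightarrow> bool" where
  "fg_right_ideal S I \<longleftrightarrow> (\<exists>X. finite X \<and> X \<subseteq> carrier S \<and> I = X <#>\<^bsub>S\<^esub> carrier S)"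

definition finitely_aligned :: "('a, 'b) monoid_scheme \<Rightarrow> bool" where
  "finitely_aligned S \<longleftrightarrow>
    (\<forall>a \<in> carrier S. \<forall>b \<in> carrier S.
      (a <#\<^bsub>S\<^esub> carrier S) \<inter> (b <#\<^bsub>S\<^esub> carrier S) = {} \<or>
      fg_right_ideal S ((a <#\<^bsub>S\<^esub> carrier S) \<inter> (b <#\<^bsub>S\<^esub> carrier S)))"


section \<open>The inverse monoid of bijective morphisms between finitely generated right ideals\<close>

definition fg_morphisms :: "('a, 'b) monoid_scheme \<Rightarrow> ('a \<rightharpoonup> 'a) set" where
  "fg_morphisms S =
    {\<alpha>. fg_right_ideal S (dom \<alpha>) \<and> fg_right_ideal S (ran \<alpha>) \<and> inj_on \<alpha> (dom \<alpha>) \<and>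
        (\<forall>a \<in> dom \<alpha>. \<forall>s \<in> carrier S. \<alpha> (a \<otimes>\<^bsub>S\<^esub> s) = Some (the (\<alpha> a) \<otimes>\<^bsub>S\<^esub> s))}"

text \<open>
  Products are composites of partial functions, the right factor being applied first.  The set of
  morphisms is closed under them when \<open>S\<close> is finitely aligned.
\<close>

definition R_monoid :: "('a, 'b) monoid_scheme \<Rightarrow> ('a \<rightharpoonup> 'a) monoid" where
  "R_monoid S =
    \<lparr>carrier = fg_morphisms S, Group.monoid.mult = (\<circ>\<^sub>m), one = Some |` carrier S\<rparr>"


section \<open>Inverse semigroups with zero\<close>

text \<open>
  The following notions are meant for inverse semigroups; the field for the unit is never used in
  them.  Definite descriptions denote the intended element whenever it exists.
\<close>

definition idempotents :: "('a, 'b) monoid_scheme \<Rightarrow> 'a set" where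
  "idempotents T = {e \<in> carrier T. e \<otimes>\<^bsub>T\<^esub> e = e}"

definition semigroup_inv :: "('a, 'b) monoid_scheme \<Rightarrow> 'a \<Rightarrow> 'a" where
  "semigroup_inv T s =
    (THE t. t \<in> carrier T \<and> s \<otimes>\<^bsub>T\<^esub> t \<otimes>\<^bsub>T\<^esub> s = s \<and> t \<otimes>\<^bsub>T\<^esub> s \<otimes>\<^bsub>T\<^esub> t = t)"

definition semigroup_zero :: "('a, 'b) monoid_scheme \<Rightarrow> 'a" where
  "semigroup_zero T =
    (THE z. z \<in> carrier T \<and> (\<forall>x \<in> carrier T. z \<otimes>\<^bsub>T\<^esub> x = z \<and> x \<otimes>\<^bsub>T\<^esub> z = z))"

text \<open>
  The natural partial order; for \<^const>\<open>R_monoid\<close> it is restriction of partial functions.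
\<close>

definition natural_order :: "('a, 'b) monoid_scheme \<Rightarrow> 'a gorder" where
  "natural_order T =
    \<lparr>carrier = carrier T, eq = (=), le = (\<lambda>s t. \<exists>e \<in> idempotents T. s = t \<otimes>\<^bsub>T\<^esub> e)\<rparr>"

definition meet_equiv :: "('a, 'b) monoid_scheme \<Rightarrow> ('a \<times> 'a) set" where
  "meet_equiv T =
    {(s, t). s \<in> carrier T \<and> t \<in> carrier T \<and>
      (\<forall>x \<in> carrier T. x \<noteq> semigroup_zero T \<and> x \<sqsubseteq>\<^bsub>natural_order T\<^esub> s \<longrightarrow>
        x \<sqinter>\<^bsub>natural_order T\<^esub> t \<noteq> semigroup_zero T) \<and>
      (\<forall>y \<in> carrier T. y \<noteq> semigroup_zero T \<and> y \<sqsubseteq>\<^bsub>natural_order T\<^esub> t \<longrightarrow>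
        y \<sqinter>\<^bsub>natural_order T\<^esub> s \<noteq> semigroup_zero T)}"

definition essential :: "('a, 'b) monoid_scheme \<Rightarrow> 'a \<Rightarrow> bool" where
  "essential T e \<longleftrightarrow>
    e \<in> idempotents T \<and> e \<noteq> semigroup_zero T \<and>
    (\<forall>f \<in> idempotents T. f \<noteq> semigroup_zero T \<longrightarrow> e \<otimes>\<^bsub>T\<^esub> f \<noteq> semigroup_zero T)"

definition essential_part :: "('a, 'b) monoid_scheme \<Rightarrow> ('a, 'b) monoid_scheme" where
  "essential_part T =
    T\<lparr>carrier := {s \<in> carrier T. essential T (semigroup_inv T s \<otimes>\<^bsub>T\<^esub> s) \<and>
                                 essential T (s \<otimes>\<^bsub>T\<^esub> semigroup_inv T s)}\<rparr>"

definition min_group_cong :: "('a, 'b) monoid_scheme \<Rightarrow> ('a \<times> 'a) set" where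
  "min_group_cong T =
    {(s, t). s \<in> carrier T \<and> t \<in> carrier T \<and>
      (\<exists>u \<in> carrier T. u \<sqsubseteq>\<^bsub>natural_order T\<^esub> s \<and> u \<sqsubseteq>\<^bsub>natural_order T\<^esub> t)}"

text \<open>
  If \<open>r\<close> is a congruence on \<open>M\<close>, the union below is the class of \<open>a \<otimes>\<^bsub>M\<^esub> b\<close> for any
  \<open>a \<in> A\<close> and \<open>b \<in> B\<close>.
\<close>

definition quotient_monoid ::
  "('a, 'b) monoid_scheme \<Rightarrow> ('a \<times> 'a) set \<Rightarrow> 'a set monoid" where
  "quotient_monoid M r =
    \<lparr>carrier = carrier M // r,
     Group.monoid.mult = (\<lambda>A B. \<Union>a \<in> A. \<Union>b \<in> B. r `` {a \<otimes>\<^bsub>M\<^esub> b}),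
     one = r `` {\<one>\<^bsub>M\<^esub>}\<rparr>"


section \<open>The monoid \<open>C(S)\<close> and the group \<open>G(S)\<close>\<close>

definition C_monoid :: "('a, 'b) monoid_scheme \<Rightarrow> ('a \<rightharpoonup> 'a) set monoid" where
  "C_monoid S = quotient_monoid (R_monoid S) (meet_equiv (R_monoid S))"

text \<open>
  The unit of \<^term>\<open>R_monoid S\<close> is an essential idempotent, so that \<^const>\<open>essential_part\<close> keeps
  the unit field meaningful.
\<close>

definition G_group :: "('a, 'b) monoid_scheme \<Rightarrow> ('a \<rightharpoonup> 'a) set monoid" where
  "G_group S =
    (let T = essential_part (R_monoid S) in quotient_monoid T (min_group_cong T))"

end

theory Submission
  imports Defs
begin

text \<open>
  Everything can be read off pointwise.  The natural partial order of \<open>R(S)\<close> is restriction, and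
  the meet of two morphisms is their restriction to the set on which they agree; this set is a
  finitely generated right ideal because a \<open>k\<close>-monoid is right cancellative, so that agreement
  on \<open>aS\<close> is decided at \<open>a\<close>.  Testing the definition of \<open>\<equiv>\<close> on restrictions to principal right
  ideals gives (\<open>meet_equiv_iff\<close>): \<open>\<alpha> \<equiv> \<beta>\<close> iff every element of the domain of \<open>\<alpha>\<close>, and every
  element of the domain of \<open>\<beta>\<close>, can be multiplied on the right into a point at which both maps are
  defined and agree.  From this it is immediate that \<open>\<equiv>\<close> is a congruence.

  Likewise, an idempotent is the identity on a finitely generated right ideal \<open>I\<close>, and it is
  essential iff \<open>I\<close> is dense: every element of \<open>S\<close> can be multiplied on the right into \<open>I\<close>.
  So \<open>R(S)\<^sup>e\<close> consists of the morphisms with dense domain and dense range.  Three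
  observations then prove the theorem.

  \<^item> Density of domain and range passes to \<open>\<equiv>\<close>-equivalent morphisms
    (\<open>dense_morphism_meet_equiv\<close>), so \<open>R(S)\<^sup>e\<close> is a union of \<open>\<equiv>\<close>-classes.

  \<^item> On \<open>R(S)\<^sup>e\<close> the relations \<open>\<equiv>\<close> and \<open>\<sigma>\<close> coincide (\<open>min_group_cong_eq\<close>): if
    \<open>\<alpha> \<equiv> \<beta>\<close> have dense domain and range, then so has their meet, which lies below both.

  \<^item> The class of \<open>\<alpha>\<close> is a unit of \<open>C(S)\<close> iff \<open>\<alpha> \<in> R(S)\<^sup>e\<close> (\<open>Units_C_monoid\<close>).  If \<open>\<alpha>\<beta> \<equiv> 1\<close> and
    \<open>\<beta>\<alpha> \<equiv> 1\<close>, every element of \<open>S\<close> can be multiplied into a fixed point of either product, hence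
    into the range and into the domain of \<open>\<alpha>\<close>.  Conversely, the identity on a dense ideal is
    equivalent to \<open>1\<close>, so the class of the inverse of \<open>\<alpha>\<close> inverts the class of \<open>\<alpha>\<close>.

  Hence the group of units of \<open>C(S)\<close> and \<open>G(S)\<close> consist of the same classes, multiplied in the
  same way, and the identity map is an isomorphism.
\<close>

section \<open>Finitely generated right ideals\<close>

text \<open>
  Unique factorization enters the argument through right cancellativity, which makes the set where
  two morphisms agree a finitely generated right ideal.
\<close>

locale right_cancellative_aligned_monoid = Group.monoid S
  for S :: "('a, 'b) monoid_scheme" (structure) +
  assumes right_cancel:
      "\<lbrakk>x \<in> carrier S; y \<in> carrier S; s \<in> carrier S; x \<otimes> s = y \<otimes> s\<rbrakk> \<Longrightarrow> x = y"
    and aligned: "finitely_aligned S"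

text \<open>
  If \<open>x s = y s\<close>, then \<open>x\<close> and \<open>y\<close> have the same degree, and both sides are factorizations of
  one element with the same pair of degrees.
\<close>

lemma (in k_monoid) right_cancellative:
  assumes "x \<in> carrier S" "y \<in> carrier S" "s \<in> carrier S" "x \<otimes> s = y \<otimes> s"
  shows "x = y"
proof -
  have "d x + d s = d y + d s"
    using assms degree_mult by metis
  then have "d x = d y"
    by simp
  have "x \<otimes> s \<in> carrier S" "d (x \<otimes> s) = d x + d s"
    using assms(1-3) degree_mult by auto
  from unique_factorization[OF this] obtain u v where
    "\<And>x1 x2. \<lbrakk>x1 \<in> carrier S; x2 \<in> carrier S; x \<otimes> s = x1 \<otimes> x2; d x1 = d x; d x2 = d s\<rbrakk> \<Longrightarrow>
      x1 = u \<and> x2 = v"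
    unfolding Ex1_def by force
  from this[of x s] this[of y s] show ?thesis
    using assms \<open>d x = d y\<close> by simp
qed

context right_cancellative_aligned_monoid
begin

abbreviation fg :: "'a set \<Rightarrow> bool" where
  "fg \<equiv> fg_right_ideal S"

lemma fg_iff:
  "fg I \<longleftrightarrow> (\<exists>X. finite X \<and> X \<subseteq> carrier S \<and> I = (\<Union>a\<in>X. a <# carrier S))"
  unfolding fg_right_ideal_def set_mult_def l_coset_def by auto

lemma fg_empty: "fg {}"
  unfolding fg_iff by (rule exI[of _ "{}"]) auto

lemma fg_principal: "a \<in> carrier S \<Longrightarrow> fg (a <# carrier S)"
  unfolding fg_iff by (rule exI[of _ "{a}"]) auto

lemma mem_principal: "a \<in> carrier S \<Longrightarrow> a \<in> a <# carrier S"
  unfolding l_coset_def by (auto intro!: bexI[of _ \<one>])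

lemma fg_carrier: "fg (carrier S)"
proof -
  have "\<one> <# carrier S = carrier S"
    unfolding l_coset_def by auto
  then show ?thesis
    using fg_principal[of \<one>] by simp
qed

lemma fg_subset: "fg I \<Longrightarrow> I \<subseteq> carrier S"
  unfolding fg_iff l_coset_def by auto

lemma fg_mult: "\<lbrakk>fg I; a \<in> I; s \<in> carrier S\<rbrakk> \<Longrightarrow> a \<otimes> s \<in> I"
  unfolding fg_iff l_coset_def by (fastforce simp: m_assoc)

lemma fg_Un: "\<lbrakk>fg I; fg J\<rbrakk> \<Longrightarrow> fg (I \<union> J)"
  unfolding fg_iff by (metis UN_Un Un_least finite_Un)

lemma fg_UN: "\<lbrakk>finite A; \<And>a. a \<in> A \<Longrightarrow> fg (f a)\<rbrakk> \<Longrightarrow> fg (\<Union>a\<in>A. f a)"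
  by (induction A rule: finite_induct) (auto simp: fg_empty fg_Un)

lemma fg_Int:
  assumes "fg I" "fg J"
  shows "fg (I \<inter> J)"
proof -
  obtain X Y where X: "finite X" "X \<subseteq> carrier S" "I = (\<Union>a\<in>X. a <# carrier S)"
    and Y: "finite Y" "Y \<subseteq> carrier S" "J = (\<Union>b\<in>Y. b <# carrier S)"
    using assms unfolding fg_iff by metis
  have "fg ((a <# carrier S) \<inter> (b <# carrier S))" if "a \<in> X" "b \<in> Y" for a b
    using aligned that X Y fg_empty unfolding finitely_aligned_def by (metis subsetD)
  then have "fg (\<Union>a\<in>X. \<Union>b\<in>Y. (a <# carrier S) \<inter> (b <# carrier S))"
    using X(1) Y(1) by (intro fg_UN)
  moreover have "I \<inter> J = (\<Union>a\<in>X. \<Union>b\<in>Y. (a <# carrier S) \<inter> (b <# carrier S))"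
    unfolding X(3) Y(3) by auto
  ultimately show ?thesis
    by simp
qed

definition dense :: "'a set \<Rightarrow> bool" where
  "dense I \<longleftrightarrow> (\<forall>a \<in> carrier S. \<exists>r \<in> carrier S. a \<otimes> r \<in> I)"


section \<open>Bijective morphisms\<close>

abbreviation Mor :: "('a \<rightharpoonup> 'a) set" where
  "Mor \<equiv> fg_morphisms S"

lemma
  assumes "\<alpha> \<in> Mor"
  shows fg_dom: "fg (dom \<alpha>)"
    and fg_ran: "fg (ran \<alpha>)"
    and morphism_inj: "\<lbrakk>\<alpha> a = Some c; \<alpha> b = Some c\<rbrakk> \<Longrightarrow> a = b"
    and morphism_mult: "\<lbrakk>\<alpha> a = Some b; s \<in> carrier S\<rbrakk> \<Longrightarrow> \<alpha> (a \<otimes> s) = Some (b \<otimes> s)"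
proof -
  note * = assms[unfolded fg_morphisms_def mem_Collect_eq]
  show "fg (dom \<alpha>)" "fg (ran \<alpha>)"
    using * by auto
  show "\<lbrakk>\<alpha> a = Some c; \<alpha> b = Some c\<rbrakk> \<Longrightarrow> a = b"
    using * by (metis domI inj_onD)
  show "\<lbrakk>\<alpha> a = Some b; s \<in> carrier S\<rbrakk> \<Longrightarrow> \<alpha> (a \<otimes> s) = Some (b \<otimes> s)"
    using * by (metis domI option.sel)
qed

lemma morphism_closed:
  assumes "\<alpha> \<in> Mor" "\<alpha> a = Some b"
  shows "a \<in> carrier S" "b \<in> carrier S"
  using fg_subset[OF fg_dom[OF assms(1)]] fg_subset[OF fg_ran[OF assms(1)]] assms(2)
  by (auto intro: ranI)

lemma morphismI:
  assumes "fg (dom \<alpha>)" "fg (ran \<alpha>)"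
    and "\<And>a b c. \<lbrakk>\<alpha> a = Some c; \<alpha> b = Some c\<rbrakk> \<Longrightarrow> a = b"
    and "\<And>a b s. \<lbrakk>\<alpha> a = Some b; s \<in> carrier S\<rbrakk> \<Longrightarrow> \<alpha> (a \<otimes> s) = Some (b \<otimes> s)"
  shows "\<alpha> \<in> Mor"
  using assms unfolding fg_morphisms_def inj_on_def by fastforce

lemma ran_restrict_eq: "ran (\<alpha> |` I) = {b. \<exists>a\<in>I. \<alpha> a = Some b}"
  by (auto simp: ran_def restrict_map_def)

lemma restrict_map_le: "\<alpha> |` I \<subseteq>\<^sub>m \<alpha>"
  by (auto simp: map_le_def)

lemma fg_ran_restrict:
  assumes "\<alpha> \<in> Mor" "fg I" "I \<subseteq> dom \<alpha>"
  shows "fg (ran (\<alpha> |` I))"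
proof -
  obtain X where X: "finite X" "X \<subseteq> carrier S" "I = (\<Union>a\<in>X. a <# carrier S)"
    using assms(2) unfolding fg_iff by metis
  have XI: "X \<subseteq> dom \<alpha>"
    using X assms(3) mem_principal by blast
  let ?Y = "(\<lambda>a. the (\<alpha> a)) ` X"
  have val: "\<alpha> (a \<otimes> s) = Some (the (\<alpha> a) \<otimes> s)" if "a \<in> X" "s \<in> carrier S" for a s
    using that XI morphism_mult[OF assms(1)] by (metis domD option.sel subsetD)
  have "ran (\<alpha> |` I) = {b. \<exists>a\<in>I. \<alpha> a = Some b}"
    by (rule ran_restrict_eq)
  also have "\<dots> = {b. \<exists>a\<in>X. \<exists>s\<in>carrier S. \<alpha> (a \<otimes> s) = Some b}"
    unfolding X(3) l_coset_def by auto
  also have "\<dots> = (\<Union>a\<in>?Y. a <# carrier S)"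
    unfolding l_coset_def using val by auto
  finally have "ran (\<alpha> |` I) = (\<Union>a\<in>?Y. a <# carrier S)" .
  moreover have "?Y \<subseteq> carrier S"
    using XI morphism_closed(2)[OF assms(1)] by auto
  ultimately show ?thesis
    unfolding fg_iff using X(1) by blast
qed

lemma restrict_morphism:
  assumes "\<alpha> \<in> Mor" "fg I"
  shows "\<alpha> |` I \<in> Mor"
proof (rule morphismI)
  show "fg (dom (\<alpha> |` I))"
    using fg_Int[OF fg_dom[OF assms(1)] assms(2)] by simp
  have "\<alpha> |` I = \<alpha> |` (dom \<alpha> \<inter> I)"
    by (auto simp: restrict_map_def fun_eq_iff)
  then show "fg (ran (\<alpha> |` I))"
    using fg_ran_restrict[OF assms(1) fg_Int[OF fg_dom[OF assms(1)] assms(2)]] by simp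
  show "a = b" if "(\<alpha> |` I) a = Some c" "(\<alpha> |` I) b = Some c" for a b c
    using that morphism_inj[OF assms(1)] by (auto simp: restrict_map_def split: if_splits)
  show "(\<alpha> |` I) (a \<otimes> s) = Some (b \<otimes> s)" if "(\<alpha> |` I) a = Some b" "s \<in> carrier S" for a b s
    using that morphism_mult[OF assms(1)] fg_mult[OF assms(2)]
    by (auto simp: restrict_map_def split: if_splits)
qed

lemma restrict_Some_iff: "(Some |` I) a = Some b \<longleftrightarrow> a \<in> I \<and> b = a"
  by (auto simp: restrict_map_def)

lemma id_on_morphism: "fg I \<Longrightarrow> Some |` I \<in> Mor"
proof (rule morphismI)
  assume I: "fg I"
  have "dom (Some |` I) = I" "ran (Some |` I) = I"
    by (auto simp: ran_def restrict_map_def split: if_splits)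
  then show "fg (dom (Some |` I))" "fg (ran (Some |` I))"
    using I by auto
qed (auto simp: restrict_Some_iff fg_mult)

definition partial_inverse :: "('a \<rightharpoonup> 'a) \<Rightarrow> ('a \<rightharpoonup> 'a)" where
  "partial_inverse \<alpha> b = (if b \<in> ran \<alpha> then Some (THE a. \<alpha> a = Some b) else None)"

lemma partial_inverse_iff:
  assumes "\<alpha> \<in> Mor"
  shows "partial_inverse \<alpha> b = Some a \<longleftrightarrow> \<alpha> a = Some b"
proof -
  have "(THE a. \<alpha> a = Some b) = a" if "\<alpha> a = Some b" for a
    using that morphism_inj[OF assms] by blast
  then show ?thesis
    unfolding partial_inverse_def by (auto simp: ran_def)
qed

lemma partial_inverse_morphism:
  assumes "\<alpha> \<in> Mor"
  shows "partial_inverse \<alpha> \<in> Mor"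
proof (rule morphismI)
  have "dom (partial_inverse \<alpha>) = ran \<alpha>" "ran (partial_inverse \<alpha>) = dom \<alpha>"
    by (auto simp: dom_def ran_def partial_inverse_iff[OF assms])
  then show "fg (dom (partial_inverse \<alpha>))" "fg (ran (partial_inverse \<alpha>))"
    using fg_dom fg_ran assms by auto
qed (auto simp: partial_inverse_iff[OF assms] morphism_mult[OF assms])

text \<open>
  Finite alignment enters here: the middle ideal \<open>ran \<beta> \<inter> dom \<alpha>\<close> is finitely generated, and
  the domain and the range of the composite are its images under the inverse of \<open>\<beta>\<close> and
  under \<open>\<alpha>\<close>.
\<close>

lemma comp_morphism:
  assumes "\<alpha> \<in> Mor" "\<beta> \<in> Mor"
  shows "\<alpha> \<circ>\<^sub>m \<beta> \<in> Mor"
proof (rule morphismI)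
  let ?I = "ran \<beta> \<inter> dom \<alpha>"
  have I: "fg ?I"
    using fg_Int fg_dom fg_ran assms by blast
  have "dom (\<alpha> \<circ>\<^sub>m \<beta>) = ran (partial_inverse \<beta> |` ?I)"
    unfolding ran_restrict_eq partial_inverse_iff[OF assms(2)]
    by (auto simp: map_comp_Some_iff dom_def intro: ranI)
  moreover have "dom (partial_inverse \<beta>) = ran \<beta>"
    by (auto simp: dom_def ran_def partial_inverse_iff[OF assms(2)])
  ultimately show "fg (dom (\<alpha> \<circ>\<^sub>m \<beta>))"
    using fg_ran_restrict[OF partial_inverse_morphism[OF assms(2)] I] by auto
  have "ran (\<alpha> \<circ>\<^sub>m \<beta>) = ran (\<alpha> |` ?I)"
    unfolding ran_restrict_eq unfolding ran_def map_comp_Some_iff by (blast intro: domI)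
  then show "fg (ran (\<alpha> \<circ>\<^sub>m \<beta>))"
    using fg_ran_restrict[OF assms(1) I] by auto
  show "a = b" if "(\<alpha> \<circ>\<^sub>m \<beta>) a = Some c" "(\<alpha> \<circ>\<^sub>m \<beta>) b = Some c" for a b c
    using that by (auto simp: map_comp_Some_iff dest: morphism_inj[OF assms(1)] morphism_inj[OF assms(2)])
  show "(\<alpha> \<circ>\<^sub>m \<beta>) (a \<otimes> s) = Some (b \<otimes> s)"
    if "(\<alpha> \<circ>\<^sub>m \<beta>) a = Some b" "s \<in> carrier S" for a b s
    using that morphism_mult[OF assms(1)] morphism_mult[OF assms(2)]
    by (auto simp: map_comp_Some_iff)
qed

text \<open>
  If \<open>\<alpha>\<close> and \<open>\<beta>\<close> agree at \<open>z s\<close>, then \<open>\<alpha>(z) s = \<beta>(z) s\<close>, so right cancellation makes them agree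
  at \<open>z\<close>.  Hence the agreement set is generated by those generators of \<open>dom \<alpha> \<inter> dom \<beta>\<close> which
  it contains.
\<close>

definition agreement :: "('a \<rightharpoonup> 'a) \<Rightarrow> ('a \<rightharpoonup> 'a) \<Rightarrow> 'a set" where
  "agreement \<alpha> \<beta> = {a. \<exists>b. \<alpha> a = Some b \<and> \<beta> a = Some b}"

lemma fg_agreement:
  assumes "\<alpha> \<in> Mor" "\<beta> \<in> Mor"
  shows "fg (agreement \<alpha> \<beta>)"
proof -
  obtain X where X: "finite X" "X \<subseteq> carrier S" "dom \<alpha> \<inter> dom \<beta> = (\<Union>a\<in>X. a <# carrier S)"
    using fg_Int[OF fg_dom[OF assms(1)] fg_dom[OF assms(2)]] unfolding fg_iff by metis
  have "agreement \<alpha> \<beta> = (\<Union>z\<in>{z \<in> X. \<alpha> z = \<beta> z}. z <# carrier S)"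
  proof (intro equalityI subsetI)
    fix a assume a: "a \<in> agreement \<alpha> \<beta>"
    then obtain z s where z: "z \<in> X" "s \<in> carrier S" "a = z \<otimes> s"
      using X(3) unfolding agreement_def l_coset_def by blast
    then have "z \<in> dom \<alpha> \<inter> dom \<beta>"
      using X mem_principal by blast
    then obtain u v where uv: "\<alpha> z = Some u" "\<beta> z = Some v"
      by auto
    then have "u \<otimes> s = v \<otimes> s"
      using a z morphism_mult[OF assms(1)] morphism_mult[OF assms(2)]
      unfolding agreement_def by auto
    then have "u = v"
      using uv z(2) right_cancel morphism_closed(2) assms by blast
    then show "a \<in> (\<Union>z\<in>{z \<in> X. \<alpha> z = \<beta> z}. z <# carrier S)"
      using z uv unfolding l_coset_def by auto
  next
    fix a assume "a \<in> (\<Union>z\<in>{z \<in> X. \<alpha> z = \<beta> z}. z <# carrier S)"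
    then obtain z s where z: "z \<in> X" "\<alpha> z = \<beta> z" "s \<in> carrier S" "a = z \<otimes> s"
      unfolding l_coset_def by auto
    then have "z \<in> dom \<alpha>"
      using X mem_principal by blast
    then obtain u where "\<alpha> z = Some u" "\<beta> z = Some u"
      using z(2) by (metis domD)
    then have "\<alpha> a = Some (u \<otimes> s)" "\<beta> a = Some (u \<otimes> s)"
      using z(3,4) morphism_mult assms by blast+
    then show "a \<in> agreement \<alpha> \<beta>"
      unfolding agreement_def by auto
  qed
  then show ?thesis
    unfolding fg_iff using X(1,2) by (intro exI[of _ "{z \<in> X. \<alpha> z = \<beta> z}"]) auto
qed


section \<open>The inverse monoid structure, pointwise\<close>

abbreviation R :: "('a \<rightharpoonup> 'a) monoid" where
  "R \<equiv> R_monoid S"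

lemma R_simps [simp]:
  "carrier R = Mor" "x \<otimes>\<^bsub>R\<^esub> y = x \<circ>\<^sub>m y" "\<one>\<^bsub>R\<^esub> = Some |` carrier S"
  unfolding R_monoid_def by auto

lemma map_Some_eqI: "(\<And>a b. f a = Some b \<longleftrightarrow> g a = Some b) \<Longrightarrow> f = g"
  by (rule ext) (metis option.exhaust)

lemma comp_id_on: "\<alpha> \<circ>\<^sub>m (Some |` I) = \<alpha> |` I"
  by (auto simp: fun_eq_iff map_comp_def restrict_map_def)

lemma semigroup_zero_R: "semigroup_zero R = Map.empty"
  unfolding semigroup_zero_def
proof (rule the_equality)
  have "Map.empty \<in> Mor"
    by (rule morphismI) (auto simp: fg_empty)
  then show "Map.empty \<in> carrier R \<and> (\<forall>x\<in>carrier R. Map.empty \<otimes>\<^bsub>R\<^esub> x = Map.empty \<and>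
      x \<otimes>\<^bsub>R\<^esub> Map.empty = Map.empty)"
    by auto
  show "z = Map.empty"
    if "z \<in> carrier R \<and> (\<forall>x\<in>carrier R. z \<otimes>\<^bsub>R\<^esub> x = z \<and> x \<otimes>\<^bsub>R\<^esub> z = z)" for z
    using that \<open>Map.empty \<in> Mor\<close> by auto
qed

lemma idempotents_R: "idempotents R = {Some |` I | I. fg I}"
proof (intro equalityI subsetI)
  fix e assume "e \<in> idempotents R"
  then have e: "e \<in> Mor" "e \<circ>\<^sub>m e = e"
    unfolding idempotents_def by auto
  have fixed: "b = a" if "e a = Some b" for a b
  proof -
    have "e b = Some b"
      using e(2) that by (metis map_comp_simps(2))
    then show ?thesis
      using that morphism_inj[OF e(1)] by blast
  qed
  have "e = Some |` dom e"
    by (rule map_Some_eqI) (auto simp: restrict_Some_iff dest: fixed)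
  then show "e \<in> {Some |` I | I. fg I}"
    using fg_dom[OF e(1)] by auto
next
  fix e :: "'a \<rightharpoonup> 'a" assume "e \<in> {Some |` I | I. fg I}"
  then obtain I where I: "e = Some |` I" "fg I"
    by auto
  moreover have "(Some |` I) \<circ>\<^sub>m (Some |` I) = Some |` I"
    by (simp add: comp_id_on)
  ultimately show "e \<in> idempotents R"
    unfolding idempotents_def using id_on_morphism by auto
qed

lemma semigroup_inv_R:
  assumes "\<alpha> \<in> Mor"
  shows "semigroup_inv R \<alpha> = partial_inverse \<alpha>"
  unfolding semigroup_inv_def
proof (rule the_equality)
  note inv = partial_inverse_iff[OF assms]
  have "\<alpha> \<circ>\<^sub>m partial_inverse \<alpha> \<circ>\<^sub>m \<alpha> = \<alpha>"
    "partial_inverse \<alpha> \<circ>\<^sub>m \<alpha> \<circ>\<^sub>m partial_inverse \<alpha> = partial_inverse \<alpha>"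
    by (rule map_Some_eqI; auto simp: map_comp_Some_iff inv dest: morphism_inj[OF assms])+
  then show "partial_inverse \<alpha> \<in> carrier R \<and> \<alpha> \<otimes>\<^bsub>R\<^esub> partial_inverse \<alpha> \<otimes>\<^bsub>R\<^esub> \<alpha> = \<alpha> \<and>
      partial_inverse \<alpha> \<otimes>\<^bsub>R\<^esub> \<alpha> \<otimes>\<^bsub>R\<^esub> partial_inverse \<alpha> = partial_inverse \<alpha>"
    using partial_inverse_morphism[OF assms] by simp
next
  fix \<beta> assume "\<beta> \<in> carrier R \<and> \<alpha> \<otimes>\<^bsub>R\<^esub> \<beta> \<otimes>\<^bsub>R\<^esub> \<alpha> = \<alpha> \<and> \<beta> \<otimes>\<^bsub>R\<^esub> \<alpha> \<otimes>\<^bsub>R\<^esub> \<beta> = \<beta>"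
  then have \<beta>: "\<beta> \<in> Mor" "\<alpha> \<circ>\<^sub>m \<beta> \<circ>\<^sub>m \<alpha> = \<alpha>" "\<beta> \<circ>\<^sub>m \<alpha> \<circ>\<^sub>m \<beta> = \<beta>"
    by auto
  (* Both directions need the injectivity of the map that is applied last. *)
  have weak: "\<delta> b = Some a"
    if \<gamma>: "\<gamma> \<in> Mor" "\<gamma> \<circ>\<^sub>m \<delta> \<circ>\<^sub>m \<gamma> = \<gamma>" "\<gamma> a = Some b" for \<gamma> \<delta> a b
  proof -
    have "(\<gamma> \<circ>\<^sub>m \<delta> \<circ>\<^sub>m \<gamma>) a = Some b"
      using \<gamma> by simp
    then obtain c where "\<delta> b = Some c" "\<gamma> c = Some b"
      using \<gamma>(3) by (auto simp: map_comp_Some_iff)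
    then show ?thesis
      using \<gamma> morphism_inj by metis
  qed
  show "\<beta> = partial_inverse \<alpha>"
    by (rule map_Some_eqI) (use weak assms \<beta> partial_inverse_iff[OF assms] in metis)
qed

lemma
  assumes "\<alpha> \<in> Mor"
  shows inv_comp: "partial_inverse \<alpha> \<circ>\<^sub>m \<alpha> = Some |` dom \<alpha>"
    and comp_inv: "\<alpha> \<circ>\<^sub>m partial_inverse \<alpha> = Some |` ran \<alpha>"
  by (rule map_Some_eqI; auto simp: map_comp_Some_iff restrict_Some_iff ran_def
      partial_inverse_iff[OF assms] dest: morphism_inj[OF assms])+

text \<open>
  A finitely generated right ideal is non-empty iff it contains a principal one, so it suffices to
  test an essential idempotent against the identities on principal right ideals.
\<close>

lemma essential_iff:
  assumes "fg I"
  shows "essential R (Some |` I) \<longleftrightarrow> dense I"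
proof
  have comp: "(Some |` I) \<circ>\<^sub>m (Some |` J) = Some |` (I \<inter> J)" for J
    by (auto simp: comp_id_on Int_commute)
  have empty_iff: "(Some |` J) = Map.empty \<longleftrightarrow> J = {}" for J
    by (auto simp: restrict_map_def fun_eq_iff split: if_splits)
  {
    assume ess: "essential R (Some |` I)"
    show "dense I"
      unfolding dense_def
    proof
      fix a assume a: "a \<in> carrier S"
      have "Some |` (a <# carrier S) \<in> idempotents R"
        unfolding idempotents_R using fg_principal[OF a] by auto
      moreover have "Some |` (a <# carrier S) \<noteq> Map.empty"
        unfolding empty_iff using mem_principal[OF a] by auto
      ultimately have "(Some |` I) \<circ>\<^sub>m (Some |` (a <# carrier S)) \<noteq> Map.empty"
        using ess unfolding essential_def semigroup_zero_R R_simps by blast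
      then have "I \<inter> (a <# carrier S) \<noteq> {}"
        unfolding comp empty_iff .
      then show "\<exists>r\<in>carrier S. a \<otimes> r \<in> I"
        unfolding l_coset_def by auto
    qed
  next
    assume dense: "dense I"
    have "I \<inter> J \<noteq> {}" if J: "fg J" "J \<noteq> {}" for J
    proof -
      obtain a where "a \<in> J"
        using J by auto
      moreover from this obtain r where "r \<in> carrier S" "a \<otimes> r \<in> I"
        using dense fg_subset[OF J(1)] unfolding dense_def by auto
      ultimately show ?thesis
        using fg_mult[OF J(1)] by blast
    qed
    moreover have "I \<noteq> {}"
      using dense unfolding dense_def by auto
    ultimately show "essential R (Some |` I)"
      unfolding essential_def semigroup_zero_R idempotents_R
      using assms by (auto simp: comp empty_iff simp del: restrict_restrict)
  }
qed

definition dense_morphisms :: "('a \<rightharpoonup> 'a) set" where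
  "dense_morphisms = {\<alpha> \<in> Mor. dense (dom \<alpha>) \<and> dense (ran \<alpha>)}"

lemma essential_part_simps [simp]:
  "carrier (essential_part R) = dense_morphisms"
  "x \<otimes>\<^bsub>essential_part R\<^esub> y = x \<circ>\<^sub>m y"
  unfolding essential_part_def dense_morphisms_def
  by (auto simp: semigroup_inv_R inv_comp comp_inv essential_iff fg_dom fg_ran)

lemma natural_order_R:
  assumes "\<alpha> \<in> Mor" "\<beta> \<in> Mor"
  shows "\<alpha> \<sqsubseteq>\<^bsub>natural_order R\<^esub> \<beta> \<longleftrightarrow> \<alpha> \<subseteq>\<^sub>m \<beta>"
proof
  assume "\<alpha> \<sqsubseteq>\<^bsub>natural_order R\<^esub> \<beta>"
  then show "\<alpha> \<subseteq>\<^sub>m \<beta>"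
    unfolding natural_order_def idempotents_R
    by (auto simp: comp_id_on restrict_map_le)
next
  assume "\<alpha> \<subseteq>\<^sub>m \<beta>"
  then have "\<alpha> = \<beta> |` dom \<alpha>"
    by (auto simp: map_le_def restrict_map_def fun_eq_iff)
  then show "\<alpha> \<sqsubseteq>\<^bsub>natural_order R\<^esub> \<beta>"
    unfolding natural_order_def idempotents_R using fg_dom[OF assms(1)]
    by (auto simp: comp_id_on)
qed

lemma meet_R:
  assumes "\<alpha> \<in> Mor" "\<beta> \<in> Mor"
  shows "\<alpha> \<sqinter>\<^bsub>natural_order R\<^esub> \<beta> = \<alpha> |` agreement \<alpha> \<beta>"
proof -
  let ?g = "\<alpha> |` agreement \<alpha> \<beta>"
  have lower: "Lower (natural_order R) {\<alpha>, \<beta>} = {\<gamma> \<in> Mor. \<gamma> \<subseteq>\<^sub>m \<alpha> \<and> \<gamma> \<subseteq>\<^sub>m \<beta>}"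
    unfolding Lower_def using assms natural_order_R by (auto simp: natural_order_def)
  have g: "?g \<in> Mor"
    using restrict_morphism fg_agreement assms by blast
  have below: "?g \<subseteq>\<^sub>m \<alpha>" "?g \<subseteq>\<^sub>m \<beta>"
    by (auto simp: map_le_def restrict_map_def agreement_def split: if_splits)
  have above: "\<gamma> \<subseteq>\<^sub>m ?g" if "\<gamma> \<subseteq>\<^sub>m \<alpha>" "\<gamma> \<subseteq>\<^sub>m \<beta>" for \<gamma>
    unfolding map_le_def
  proof
    fix a assume "a \<in> dom \<gamma>"
    then obtain b where "\<gamma> a = Some b"
      by auto
    moreover from this have "\<alpha> a = Some b" "\<beta> a = Some b"
      using that unfolding map_le_def by force+
    ultimately show "\<gamma> a = ?g a"
      by (auto simp: agreement_def restrict_map_def)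
  qed
  have carr: "carrier (natural_order R) = Mor"
    by (simp add: natural_order_def)
  have "greatest (natural_order R) \<gamma> (Lower (natural_order R) {\<alpha>, \<beta>}) \<longleftrightarrow> \<gamma> = ?g" for \<gamma>
  proof
    assume "greatest (natural_order R) \<gamma> (Lower (natural_order R) {\<alpha>, \<beta>})"
    then have \<gamma>: "\<gamma> \<in> Mor" "\<gamma> \<subseteq>\<^sub>m \<alpha>" "\<gamma> \<subseteq>\<^sub>m \<beta>" "?g \<sqsubseteq>\<^bsub>natural_order R\<^esub> \<gamma>"
      unfolding greatest_def lower using g below by auto
    then show "\<gamma> = ?g"
      using above natural_order_R[OF g] map_le_antisym by blast
  next
    assume "\<gamma> = ?g"
    then show "greatest (natural_order R) \<gamma> (Lower (natural_order R) {\<alpha>, \<beta>})"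
      unfolding greatest_def lower using g below above natural_order_R
      by (auto simp: carr)
  qed
  then show ?thesis
    unfolding meet_def inf_def by simp
qed


section \<open>The congruence and the essential part\<close>

text \<open>
  One half of \<open>\<alpha> \<equiv> \<beta>\<close> in terms of points: every element of \<open>dom \<alpha>\<close> can be multiplied on the
  right into the agreement set.  Both \<open>\<equiv>\<close> and the comparison with \<open>\<sigma>\<close> are treated in this form.
\<close>

definition densely_agrees :: "('a \<rightharpoonup> 'a) \<Rightarrow> ('a \<rightharpoonup> 'a) \<Rightarrow> bool" where
  "densely_agrees \<alpha> \<beta> \<longleftrightarrow> (\<forall>a \<in> dom \<alpha>. \<exists>r \<in> carrier S. a \<otimes> r \<in> agreement \<alpha> \<beta>)"

text \<open>
  Every non-zero restriction of \<open>\<alpha>\<close> contains the restriction to some \<open>aS\<close> with \<open>a \<in> dom \<alpha>\<close>, and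
  the latter has non-zero meet with \<open>\<beta>\<close> iff \<open>\<alpha>\<close> and \<open>\<beta>\<close> agree somewhere on \<open>aS\<close>.
\<close>

lemma meets_restrictions_iff:
  assumes "\<alpha> \<in> Mor" "\<beta> \<in> Mor"
  shows "(\<forall>x \<in> Mor. x \<noteq> Map.empty \<and> x \<sqsubseteq>\<^bsub>natural_order R\<^esub> \<alpha> \<longrightarrow>
      x \<sqinter>\<^bsub>natural_order R\<^esub> \<beta> \<noteq> Map.empty) \<longleftrightarrow> densely_agrees \<alpha> \<beta>"
proof
  have nonzero: "x \<sqinter>\<^bsub>natural_order R\<^esub> \<beta> \<noteq> Map.empty \<longleftrightarrow> agreement x \<beta> \<noteq> {}"
    if "x \<in> Mor" for x
    unfolding meet_R[OF that assms(2)]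
    by (auto simp: restrict_map_def agreement_def fun_eq_iff split: if_splits)
  {
    assume L: "\<forall>x \<in> Mor. x \<noteq> Map.empty \<and> x \<sqsubseteq>\<^bsub>natural_order R\<^esub> \<alpha> \<longrightarrow>
      x \<sqinter>\<^bsub>natural_order R\<^esub> \<beta> \<noteq> Map.empty"
    show "densely_agrees \<alpha> \<beta>"
      unfolding densely_agrees_def
    proof
      fix a assume a: "a \<in> dom \<alpha>"
      then have aS: "a \<in> carrier S"
        using fg_subset fg_dom assms by blast
      let ?x = "\<alpha> |` (a <# carrier S)"
      have x: "?x \<in> Mor"
        using restrict_morphism fg_principal assms aS by blast
      moreover have "?x \<noteq> Map.empty"
        using a mem_principal[OF aS] by (metis domIff restrict_in)
      moreover have "?x \<subseteq>\<^sub>m \<alpha>"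
        by (auto simp: map_le_def restrict_map_def split: if_splits)
      ultimately have "agreement ?x \<beta> \<noteq> {}"
        using L nonzero natural_order_R[OF x assms(1)] by blast
      then show "\<exists>r\<in>carrier S. a \<otimes> r \<in> agreement \<alpha> \<beta>"
        unfolding agreement_def l_coset_def by (auto simp: restrict_map_def split: if_splits)
    qed
  next
    assume D: "densely_agrees \<alpha> \<beta>"
    show "\<forall>x \<in> Mor. x \<noteq> Map.empty \<and> x \<sqsubseteq>\<^bsub>natural_order R\<^esub> \<alpha> \<longrightarrow>
      x \<sqinter>\<^bsub>natural_order R\<^esub> \<beta> \<noteq> Map.empty"
    proof (intro ballI impI, elim conjE)
      fix x assume x: "x \<in> Mor" "x \<noteq> Map.empty" "x \<sqsubseteq>\<^bsub>natural_order R\<^esub> \<alpha>"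
      then have le: "x \<subseteq>\<^sub>m \<alpha>"
        using natural_order_R assms by blast
      obtain a b where ab: "x a = Some b"
        using x(2) by (meson not_Some_eq ext)
      then have "a \<in> dom \<alpha>"
        using le map_le_implies_dom_le by blast
      then obtain r where r: "r \<in> carrier S" "a \<otimes> r \<in> agreement \<alpha> \<beta>"
        using D unfolding densely_agrees_def by blast
      have "x (a \<otimes> r) = Some (b \<otimes> r)"
        using morphism_mult x(1) ab r(1) by blast
      then have "a \<otimes> r \<in> agreement x \<beta>"
        using r(2) le unfolding agreement_def map_le_def by force
      then show "x \<sqinter>\<^bsub>natural_order R\<^esub> \<beta> \<noteq> Map.empty"
        using nonzero x(1) by blast
    qed
  }
qed

lemma meet_equiv_iff:
  "(\<alpha>, \<beta>) \<in> meet_equiv R \<longleftrightarrow>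
    \<alpha> \<in> Mor \<and> \<beta> \<in> Mor \<and> densely_agrees \<alpha> \<beta> \<and> densely_agrees \<beta> \<alpha>"
  unfolding meet_equiv_def semigroup_zero_R R_simps
  using meets_restrictions_iff by auto

lemma densely_agreesD:
  assumes "densely_agrees \<alpha> \<beta>" "\<alpha> a = Some b" "\<alpha> \<in> Mor"
  obtains r where "r \<in> carrier S" "\<alpha> (a \<otimes> r) = Some (b \<otimes> r)" "\<beta> (a \<otimes> r) = Some (b \<otimes> r)"
proof -
  obtain r where r: "r \<in> carrier S" "a \<otimes> r \<in> agreement \<alpha> \<beta>"
    using assms(1,2) unfolding densely_agrees_def by blast
  moreover have "\<alpha> (a \<otimes> r) = Some (b \<otimes> r)"
    using morphism_mult assms r by blast
  ultimately show ?thesis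
    using that unfolding agreement_def by auto
qed

lemma densely_agreesI:
  assumes "\<And>a b. \<alpha> a = Some b \<Longrightarrow>
    \<exists>r\<in>carrier S. \<exists>c. \<alpha> (a \<otimes> r) = Some c \<and> \<beta> (a \<otimes> r) = Some c"
  shows "densely_agrees \<alpha> \<beta>"
  using assms unfolding densely_agrees_def agreement_def by blast

lemma densely_agrees_trans:
  assumes "\<alpha> \<in> Mor" "\<beta> \<in> Mor" "densely_agrees \<alpha> \<beta>" "densely_agrees \<beta> \<gamma>"
  shows "densely_agrees \<alpha> \<gamma>"
proof (rule densely_agreesI)
  fix a b assume ab: "\<alpha> a = Some b"
  then obtain r where r: "r \<in> carrier S" "\<alpha> (a \<otimes> r) = Some (b \<otimes> r)" "\<beta> (a \<otimes> r) = Some (b \<otimes> r)"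
    using densely_agreesD assms by metis
  then obtain s where s: "s \<in> carrier S" "\<gamma> (a \<otimes> r \<otimes> s) = Some (b \<otimes> r \<otimes> s)"
    using densely_agreesD assms by metis
  moreover have "\<alpha> (a \<otimes> r \<otimes> s) = Some (b \<otimes> r \<otimes> s)"
    using morphism_mult assms r s by blast
  moreover have "a \<otimes> r \<otimes> s = a \<otimes> (r \<otimes> s)"
    using m_assoc morphism_closed(1)[OF assms(1) ab] r s by blast
  ultimately show "\<exists>r\<in>carrier S. \<exists>c. \<alpha> (a \<otimes> r) = Some c \<and> \<gamma> (a \<otimes> r) = Some c"
    using r by (metis m_closed)
qed

lemma densely_agrees_comp:
  assumes "\<alpha> \<in> Mor" "\<alpha>' \<in> Mor" "\<beta> \<in> Mor" "\<beta>' \<in> Mor"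
    and "densely_agrees \<alpha> \<alpha>'" "densely_agrees \<beta> \<beta>'"
  shows "densely_agrees (\<alpha> \<circ>\<^sub>m \<beta>) (\<alpha>' \<circ>\<^sub>m \<beta>')"
proof (rule densely_agreesI)
  fix a c assume "(\<alpha> \<circ>\<^sub>m \<beta>) a = Some c"
  then obtain b where b: "\<beta> a = Some b" "\<alpha> b = Some c"
    by (auto simp: map_comp_Some_iff)
  then obtain r where r: "r \<in> carrier S" "\<beta> (a \<otimes> r) = Some (b \<otimes> r)" "\<beta>' (a \<otimes> r) = Some (b \<otimes> r)"
    using densely_agreesD assms by metis
  moreover have "\<alpha> (b \<otimes> r) = Some (c \<otimes> r)"
    using morphism_mult assms b r by blast
  ultimately obtain s where s: "s \<in> carrier S" "\<alpha> (b \<otimes> r \<otimes> s) = Some (c \<otimes> r \<otimes> s)"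
      "\<alpha>' (b \<otimes> r \<otimes> s) = Some (c \<otimes> r \<otimes> s)"
    using densely_agreesD assms by metis
  have "\<beta> (a \<otimes> r \<otimes> s) = Some (b \<otimes> r \<otimes> s)" "\<beta>' (a \<otimes> r \<otimes> s) = Some (b \<otimes> r \<otimes> s)"
    using morphism_mult assms r s by blast+
  moreover have "a \<otimes> r \<otimes> s = a \<otimes> (r \<otimes> s)"
    using m_assoc morphism_closed(1)[OF assms(3) b(1)] r s by blast
  ultimately show "\<exists>r\<in>carrier S. \<exists>c. (\<alpha> \<circ>\<^sub>m \<beta>) (a \<otimes> r) = Some c \<and> (\<alpha>' \<circ>\<^sub>m \<beta>') (a \<otimes> r) = Some c"
    using r s by (intro bexI[of _ "r \<otimes> s"] exI[of _ "c \<otimes> r \<otimes> s"]) simp_all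
qed

lemma equiv_meet_equiv: "equiv Mor (meet_equiv R)"
proof (rule equivI)
  have "densely_agrees \<alpha> \<alpha>" if "\<alpha> \<in> Mor" for \<alpha>
  proof (rule densely_agreesI)
    show "\<exists>r\<in>carrier S. \<exists>c. \<alpha> (a \<otimes> r) = Some c \<and> \<alpha> (a \<otimes> r) = Some c" if "\<alpha> a = Some b" for a b
      using morphism_mult[OF \<open>\<alpha> \<in> Mor\<close> that] by blast
  qed
  then show "refl_on Mor (meet_equiv R)"
    by (auto simp: refl_on_def meet_equiv_iff)
  show "meet_equiv R \<subseteq> Mor \<times> Mor"
    by (auto simp: meet_equiv_iff)
  show "sym (meet_equiv R)"
    by (auto simp: sym_def meet_equiv_iff)
  show "trans (meet_equiv R)"
    by (auto simp: trans_def meet_equiv_iff intro: densely_agrees_trans)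
qed

lemma meet_equiv_comp:
  "\<lbrakk>(\<alpha>, \<alpha>') \<in> meet_equiv R; (\<beta>, \<beta>') \<in> meet_equiv R\<rbrakk> \<Longrightarrow>
    (\<alpha> \<circ>\<^sub>m \<beta>, \<alpha>' \<circ>\<^sub>m \<beta>') \<in> meet_equiv R"
  unfolding meet_equiv_iff by (meson comp_morphism densely_agrees_comp)

lemma dense_dom_agreement:
  assumes "\<alpha> \<in> Mor" "densely_agrees \<alpha> \<beta>" "dense (dom \<alpha>)"
  shows "dense (agreement \<alpha> \<beta>)"
  unfolding dense_def
proof
  fix a assume a: "a \<in> carrier S"
  then obtain r where r: "r \<in> carrier S" "a \<otimes> r \<in> dom \<alpha>"
    using assms(3) unfolding dense_def by blast
  then obtain s where s: "s \<in> carrier S" "a \<otimes> r \<otimes> s \<in> agreement \<alpha> \<beta>"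
    using assms(2) unfolding densely_agrees_def by blast
  then show "\<exists>r\<in>carrier S. a \<otimes> r \<in> agreement \<alpha> \<beta>"
    using a r by (metis m_assoc m_closed)
qed

lemma dense_ran_agreement:
  assumes "\<alpha> \<in> Mor" "densely_agrees \<alpha> \<beta>" "dense (ran \<alpha>)"
  shows "dense (ran (\<alpha> |` agreement \<alpha> \<beta>))"
  unfolding dense_def
proof
  fix b assume b: "b \<in> carrier S"
  then obtain r a where r: "r \<in> carrier S" "\<alpha> a = Some (b \<otimes> r)"
    using assms(3) unfolding dense_def by (auto simp: ran_def)
  then obtain s where s: "s \<in> carrier S" "\<alpha> (a \<otimes> s) = Some (b \<otimes> r \<otimes> s)"
      "\<beta> (a \<otimes> s) = Some (b \<otimes> r \<otimes> s)"
    using densely_agreesD assms by metis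
  then have "(\<alpha> |` agreement \<alpha> \<beta>) (a \<otimes> s) = Some (b \<otimes> (r \<otimes> s))"
    using b r by (simp add: restrict_map_def agreement_def m_assoc)
  then show "\<exists>r\<in>carrier S. b \<otimes> r \<in> ran (\<alpha> |` agreement \<alpha> \<beta>)"
    using r s by (meson m_closed ranI)
qed

lemma dense_mono: "\<lbrakk>dense I; I \<subseteq> J\<rbrakk> \<Longrightarrow> dense J"
  unfolding dense_def by blast

lemma dense_meet:
  assumes "\<alpha> \<in> dense_morphisms" "\<beta> \<in> Mor" "densely_agrees \<alpha> \<beta>"
  shows "\<alpha> |` agreement \<alpha> \<beta> \<in> dense_morphisms"
proof -
  have "dom (\<alpha> |` agreement \<alpha> \<beta>) = agreement \<alpha> \<beta>"
    by (auto simp: agreement_def)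
  then show ?thesis
    using assms dense_dom_agreement dense_ran_agreement restrict_morphism fg_agreement
    unfolding dense_morphisms_def by auto
qed

lemma dense_morphism_meet_equiv:
  assumes "(\<alpha>, \<beta>) \<in> meet_equiv R" "\<alpha> \<in> dense_morphisms"
  shows "\<beta> \<in> dense_morphisms"
proof -
  have \<beta>: "\<beta> \<in> Mor" and meet: "\<alpha> |` agreement \<alpha> \<beta> \<in> dense_morphisms"
    using assms dense_meet by (auto simp: meet_equiv_iff)
  have "dom (\<alpha> |` agreement \<alpha> \<beta>) \<subseteq> dom \<beta>" "ran (\<alpha> |` agreement \<alpha> \<beta>) \<subseteq> ran \<beta>"
    by (auto simp: agreement_def ran_def restrict_map_def split: if_splits)
  then show ?thesis
    using \<beta> meet dense_mono unfolding dense_morphisms_def by blast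
qed

text \<open>
  The order of the subsemigroup \<open>R(S)\<^sup>e\<close> is defined through its own idempotents.  It is
  nevertheless restriction: if \<open>\<alpha>\<close> is a restriction of \<open>\<beta>\<close> and has a dense domain, the identity on
  this domain is an idempotent of \<open>R(S)\<^sup>e\<close>.
\<close>

lemma natural_order_essential_part:
  assumes "\<alpha> \<in> dense_morphisms" "\<beta> \<in> dense_morphisms"
  shows "\<alpha> \<sqsubseteq>\<^bsub>natural_order (essential_part R)\<^esub> \<beta> \<longleftrightarrow> \<alpha> \<subseteq>\<^sub>m \<beta>"
proof
  have mor: "\<alpha> \<in> Mor" "\<beta> \<in> Mor"
    using assms unfolding dense_morphisms_def by auto
  have idem: "idempotents (essential_part R) = idempotents R \<inter> dense_morphisms"
    unfolding idempotents_def by (auto simp: dense_morphisms_def)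
  {
    assume "\<alpha> \<sqsubseteq>\<^bsub>natural_order (essential_part R)\<^esub> \<beta>"
    then have "\<alpha> \<sqsubseteq>\<^bsub>natural_order R\<^esub> \<beta>"
      unfolding natural_order_def idem by auto
    then show "\<alpha> \<subseteq>\<^sub>m \<beta>"
      using natural_order_R mor by blast
  next
    assume "\<alpha> \<subseteq>\<^sub>m \<beta>"
    then have "\<alpha> = \<beta> \<circ>\<^sub>m (Some |` dom \<alpha>)"
      unfolding comp_id_on by (auto simp: map_le_def restrict_map_def fun_eq_iff)
    moreover have "ran (Some |` dom \<alpha>) = dom \<alpha>"
      by (auto simp: ran_def restrict_map_def split: if_splits)
    then have "Some |` dom \<alpha> \<in> idempotents R \<inter> dense_morphisms"
      using fg_dom[OF mor(1)] assms(1) id_on_morphism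
      unfolding idempotents_R dense_morphisms_def by auto
    ultimately show "\<alpha> \<sqsubseteq>\<^bsub>natural_order (essential_part R)\<^esub> \<beta>"
      unfolding natural_order_def idem by auto
  }
qed

lemma densely_agrees_of_common_restriction:
  assumes "\<alpha> \<in> Mor" "\<gamma> \<in> dense_morphisms" "\<gamma> \<subseteq>\<^sub>m \<alpha>" "\<gamma> \<subseteq>\<^sub>m \<beta>"
  shows "densely_agrees \<alpha> \<beta>"
proof (rule densely_agreesI)
  fix a b assume "\<alpha> a = Some b"
  then have "a \<in> carrier S"
    using morphism_closed assms by blast
  then obtain r c where "r \<in> carrier S" "\<gamma> (a \<otimes> r) = Some c"
    using assms(2) unfolding dense_morphisms_def dense_def by blast
  then show "\<exists>r\<in>carrier S. \<exists>c. \<alpha> (a \<otimes> r) = Some c \<and> \<beta> (a \<otimes> r) = Some c"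
    using assms(3,4) unfolding map_le_def by force
qed

lemma min_group_cong_eq:
  "min_group_cong (essential_part R) = meet_equiv R \<inter> dense_morphisms \<times> dense_morphisms"
proof -
  have "(\<exists>\<gamma>\<in>dense_morphisms. \<gamma> \<subseteq>\<^sub>m \<alpha> \<and> \<gamma> \<subseteq>\<^sub>m \<beta>) \<longleftrightarrow> (\<alpha>, \<beta>) \<in> meet_equiv R"
    if "\<alpha> \<in> dense_morphisms" "\<beta> \<in> dense_morphisms" for \<alpha> \<beta>
  proof
    have mor: "\<alpha> \<in> Mor" "\<beta> \<in> Mor"
      using that unfolding dense_morphisms_def by auto
    {
      assume "\<exists>\<gamma>\<in>dense_morphisms. \<gamma> \<subseteq>\<^sub>m \<alpha> \<and> \<gamma> \<subseteq>\<^sub>m \<beta>"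
      then show "(\<alpha>, \<beta>) \<in> meet_equiv R"
        using mor densely_agrees_of_common_restriction unfolding meet_equiv_iff by blast
    next
      assume "(\<alpha>, \<beta>) \<in> meet_equiv R"
      then have "\<alpha> |` agreement \<alpha> \<beta> \<in> dense_morphisms"
        using that mor dense_meet unfolding meet_equiv_iff by blast
      moreover have "\<alpha> |` agreement \<alpha> \<beta> \<subseteq>\<^sub>m \<alpha>" "\<alpha> |` agreement \<alpha> \<beta> \<subseteq>\<^sub>m \<beta>"
        by (auto simp: map_le_def restrict_map_def agreement_def split: if_splits)
      ultimately show "\<exists>\<gamma>\<in>dense_morphisms. \<gamma> \<subseteq>\<^sub>m \<alpha> \<and> \<gamma> \<subseteq>\<^sub>m \<beta>"
        by blast
    }
  qed
  moreover have "(\<alpha>, \<beta>) \<in> min_group_cong (essential_part R) \<longleftrightarrow>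
      \<alpha> \<in> dense_morphisms \<and> \<beta> \<in> dense_morphisms \<and>
      (\<exists>\<gamma>\<in>dense_morphisms. \<gamma> \<subseteq>\<^sub>m \<alpha> \<and> \<gamma> \<subseteq>\<^sub>m \<beta>)" for \<alpha> \<beta>
    using natural_order_essential_part unfolding min_group_cong_def by auto
  ultimately have "(\<alpha>, \<beta>) \<in> min_group_cong (essential_part R) \<longleftrightarrow>
      (\<alpha>, \<beta>) \<in> meet_equiv R \<inter> dense_morphisms \<times> dense_morphisms" for \<alpha> \<beta>
    by blast
  then show ?thesis
    by (simp only: set_eq_iff split_paired_All simp_thms)
qed


section \<open>The units of the quotient\<close>

lemma min_group_cong_class:
  assumes "\<alpha> \<in> dense_morphisms"
  shows "min_group_cong (essential_part R) `` {\<alpha>} = meet_equiv R `` {\<alpha>}"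
  unfolding min_group_cong_eq using assms dense_morphism_meet_equiv by blast

lemma carrier_G_group: "carrier (G_group S) = (\<lambda>\<alpha>. meet_equiv R `` {\<alpha>}) ` dense_morphisms"
  unfolding G_group_def quotient_monoid_def Let_def quotient_def
  by (auto simp: min_group_cong_class)

lemma carrier_C_monoid: "carrier (C_monoid S) = (\<lambda>\<alpha>. meet_equiv R `` {\<alpha>}) ` Mor"
  unfolding C_monoid_def quotient_monoid_def quotient_def by auto

lemma mult_C_monoid:
  assumes "\<alpha> \<in> Mor" "\<beta> \<in> Mor"
  shows "meet_equiv R `` {\<alpha>} \<otimes>\<^bsub>C_monoid S\<^esub> meet_equiv R `` {\<beta>} = meet_equiv R `` {\<alpha> \<circ>\<^sub>m \<beta>}"
proof -
  note eq = equiv_meet_equiv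
  have "meet_equiv R `` {\<alpha>' \<circ>\<^sub>m \<beta>'} = meet_equiv R `` {\<alpha> \<circ>\<^sub>m \<beta>}"
    if "(\<alpha>, \<alpha>') \<in> meet_equiv R" "(\<beta>, \<beta>') \<in> meet_equiv R" for \<alpha>' \<beta>'
    using meet_equiv_comp[OF that] equiv_class_eq[OF eq] by simp
  moreover have "\<alpha> \<in> meet_equiv R `` {\<alpha>}" "\<beta> \<in> meet_equiv R `` {\<beta>}"
    using assms equiv_class_self[OF eq] by auto
  ultimately show ?thesis
    unfolding C_monoid_def quotient_monoid_def by (auto simp del: Image_singleton_iff)
qed

lemma dense_morphisms_comp:
  assumes "\<alpha> \<in> dense_morphisms" "\<beta> \<in> dense_morphisms"
  shows "\<alpha> \<circ>\<^sub>m \<beta> \<in> dense_morphisms"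
proof -
  have mor: "\<alpha> \<in> Mor" "\<beta> \<in> Mor"
    using assms unfolding dense_morphisms_def by auto
  have "dense (dom (\<alpha> \<circ>\<^sub>m \<beta>))"
    unfolding dense_def
  proof
    fix a assume a: "a \<in> carrier S"
    then obtain r b where r: "r \<in> carrier S" "\<beta> (a \<otimes> r) = Some b"
      using assms(2) unfolding dense_morphisms_def dense_def by blast
    then obtain s c where s: "s \<in> carrier S" "\<alpha> (b \<otimes> s) = Some c"
      using assms(1) morphism_closed[OF mor(2) r(2)]
      unfolding dense_morphisms_def dense_def by blast
    have "\<beta> (a \<otimes> (r \<otimes> s)) = Some (b \<otimes> s)"
      using morphism_mult[OF mor(2) r(2) s(1)] a r s by (simp add: m_assoc)
    then show "\<exists>r\<in>carrier S. a \<otimes> r \<in> dom (\<alpha> \<circ>\<^sub>m \<beta>)"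
      using r s by (metis domI m_closed map_comp_simps(2))
  qed
  moreover have "dense (ran (\<alpha> \<circ>\<^sub>m \<beta>))"
    unfolding dense_def
  proof
    fix c assume c: "c \<in> carrier S"
    then obtain r b where r: "r \<in> carrier S" "\<alpha> b = Some (c \<otimes> r)"
      using assms(1) unfolding dense_morphisms_def dense_def by (auto simp: ran_def)
    then obtain s a where s: "s \<in> carrier S" "\<beta> a = Some (b \<otimes> s)"
      using assms(2) morphism_closed[OF mor(1) r(2)]
      unfolding dense_morphisms_def dense_def by (auto simp: ran_def)
    have "\<alpha> (b \<otimes> s) = Some (c \<otimes> (r \<otimes> s))"
      using morphism_mult[OF mor(1) r(2) s(1)] c r s by (simp add: m_assoc)
    then show "\<exists>r\<in>carrier S. c \<otimes> r \<in> ran (\<alpha> \<circ>\<^sub>m \<beta>)"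
      using r s by (metis ranI m_closed map_comp_simps(2))
  qed
  ultimately show ?thesis
    using comp_morphism mor unfolding dense_morphisms_def by auto
qed

text \<open>
  Both products are unions over representatives, and for representatives with dense domain and
  range the two relations have the same classes.
\<close>

lemma mult_G_group:
  assumes "\<alpha> \<in> dense_morphisms" "\<beta> \<in> dense_morphisms"
  shows "meet_equiv R `` {\<alpha>} \<otimes>\<^bsub>G_group S\<^esub> meet_equiv R `` {\<beta>} =
    meet_equiv R `` {\<alpha>} \<otimes>\<^bsub>C_monoid S\<^esub> meet_equiv R `` {\<beta>}"
proof -
  have "min_group_cong (essential_part R) `` {\<alpha>' \<circ>\<^sub>m \<beta>'} = meet_equiv R `` {\<alpha>' \<circ>\<^sub>m \<beta>'}"
    if "\<alpha>' \<in> meet_equiv R `` {\<alpha>}" "\<beta>' \<in> meet_equiv R `` {\<beta>}" for \<alpha>' \<beta>'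
    using that assms dense_morphism_meet_equiv
    by (intro min_group_cong_class dense_morphisms_comp) auto
  then show ?thesis
    unfolding G_group_def C_monoid_def quotient_monoid_def Let_def by simp
qed

text \<open>
  If every element of \<open>S\<close> can be multiplied into a fixed point of \<open>\<alpha>\<beta>\<close>, then it can be
  multiplied into the range of \<open>\<alpha>\<close> and into the domain of \<open>\<beta>\<close>.
\<close>

lemma dense_if_comp_equiv_one:
  assumes "(Some |` carrier S, \<alpha> \<circ>\<^sub>m \<beta>) \<in> meet_equiv R"
  shows "dense (ran \<alpha>)" "dense (dom \<beta>)"
proof -
  have "\<exists>r\<in>carrier S. (\<alpha> \<circ>\<^sub>m \<beta>) (a \<otimes> r) = Some (a \<otimes> r)" if "a \<in> carrier S" for a
  proof -
    have "(Some |` carrier S) a = Some a"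
      using that by simp
    then show ?thesis
      using assms densely_agreesD unfolding meet_equiv_iff by metis
  qed
  then show "dense (ran \<alpha>)" "dense (dom \<beta>)"
    unfolding dense_def by (auto simp: ran_def map_comp_Some_iff; blast)+
qed

lemma id_on_dense_equiv_one:
  assumes "fg I" "dense I"
  shows "(Some |` I, Some |` carrier S) \<in> meet_equiv R"
proof -
  have I: "Some |` I \<subseteq>\<^sub>m Some |` carrier S"
    using fg_subset[OF assms(1)] by (auto simp: map_le_def restrict_map_def split: if_splits)
  have "ran (Some |` I) = I"
    by (auto simp: ran_def restrict_map_def split: if_splits)
  then have "Some |` I \<in> dense_morphisms"
    using assms id_on_morphism unfolding dense_morphisms_def by simp
  then show ?thesis
    unfolding meet_equiv_iff
    using I assms(1) id_on_morphism fg_carrier densely_agrees_of_common_restriction map_le_refl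
    by blast
qed

lemma Units_C_monoid:
  "Units (C_monoid S) = (\<lambda>\<alpha>. meet_equiv R `` {\<alpha>}) ` dense_morphisms"
proof (intro equalityI subsetI)
  note eq = equiv_meet_equiv
  have one: "\<one>\<^bsub>C_monoid S\<^esub> = meet_equiv R `` {Some |` carrier S}"
    unfolding C_monoid_def quotient_monoid_def by simp
  {
    fix A assume "A \<in> Units (C_monoid S)"
    then obtain B where A: "A \<in> carrier (C_monoid S)" and B: "B \<in> carrier (C_monoid S)"
      and AB: "A \<otimes>\<^bsub>C_monoid S\<^esub> B = \<one>\<^bsub>C_monoid S\<^esub>" "B \<otimes>\<^bsub>C_monoid S\<^esub> A = \<one>\<^bsub>C_monoid S\<^esub>"
      unfolding Units_def by blast
    obtain \<alpha> \<beta> where \<alpha>: "\<alpha> \<in> Mor" "A = meet_equiv R `` {\<alpha>}"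
      and \<beta>: "\<beta> \<in> Mor" "B = meet_equiv R `` {\<beta>}"
      using A B unfolding carrier_C_monoid by auto
    have "(Some |` carrier S, \<alpha> \<circ>\<^sub>m \<beta>) \<in> meet_equiv R"
      "(Some |` carrier S, \<beta> \<circ>\<^sub>m \<alpha>) \<in> meet_equiv R"
      using AB \<alpha> \<beta> one eq_equiv_class[OF _ eq] comp_morphism mult_C_monoid by metis+
    then have "\<alpha> \<in> dense_morphisms"
      unfolding dense_morphisms_def using \<alpha>(1) dense_if_comp_equiv_one by blast
    then show "A \<in> (\<lambda>\<alpha>. meet_equiv R `` {\<alpha>}) ` dense_morphisms"
      using \<alpha>(2) by blast
  next
    fix A assume "A \<in> (\<lambda>\<alpha>. meet_equiv R `` {\<alpha>}) ` dense_morphisms"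
    then obtain \<alpha> where \<alpha>: "\<alpha> \<in> Mor" "dense (dom \<alpha>)" "dense (ran \<alpha>)"
        "A = meet_equiv R `` {\<alpha>}"
      unfolding dense_morphisms_def by auto
    let ?B = "meet_equiv R `` {partial_inverse \<alpha>}"
    have inv: "partial_inverse \<alpha> \<in> Mor"
      using partial_inverse_morphism \<alpha> by blast
    have "A \<otimes>\<^bsub>C_monoid S\<^esub> ?B = \<one>\<^bsub>C_monoid S\<^esub>" "?B \<otimes>\<^bsub>C_monoid S\<^esub> A = \<one>\<^bsub>C_monoid S\<^esub>"
      unfolding \<alpha>(4) one mult_C_monoid[OF \<alpha>(1) inv] mult_C_monoid[OF inv \<alpha>(1)]
        inv_comp[OF \<alpha>(1)] comp_inv[OF \<alpha>(1)]
      using equiv_class_eq[OF eq id_on_dense_equiv_one] \<alpha> fg_dom fg_ran by blast+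
    moreover have "A \<in> carrier (C_monoid S)" "?B \<in> carrier (C_monoid S)"
      using \<alpha> inv unfolding carrier_C_monoid by auto
    ultimately show "A \<in> Units (C_monoid S)"
      unfolding Units_def by blast
  }
qed

theorem units_of_C_monoid_iso_G_group: "units_of (C_monoid S) \<cong> G_group S"
proof -
  have carrier: "carrier (units_of (C_monoid S)) = carrier (G_group S)"
    unfolding units_of_carrier Units_C_monoid carrier_G_group ..
  have "x \<otimes>\<^bsub>G_group S\<^esub> y = x \<otimes>\<^bsub>units_of (C_monoid S)\<^esub> y"
    "x \<otimes>\<^bsub>G_group S\<^esub> y \<in> carrier (G_group S)"
    if xy: "x \<in> carrier (G_group S)" "y \<in> carrier (G_group S)" for x y
  proof -
    obtain \<alpha> \<beta> where \<alpha>: "\<alpha> \<in> dense_morphisms" "x = meet_equiv R `` {\<alpha>}"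
      and \<beta>: "\<beta> \<in> dense_morphisms" "y = meet_equiv R `` {\<beta>}"
      using xy unfolding carrier_G_group by (elim imageE)
    have "\<alpha> \<in> Mor" "\<beta> \<in> Mor"
      using \<alpha>(1) \<beta>(1) unfolding dense_morphisms_def by simp_all
    then have "x \<otimes>\<^bsub>G_group S\<^esub> y = meet_equiv R `` {\<alpha> \<circ>\<^sub>m \<beta>}"
      unfolding \<alpha>(2) \<beta>(2) mult_G_group[OF \<alpha>(1) \<beta>(1)] by (rule mult_C_monoid)
    then show "x \<otimes>\<^bsub>G_group S\<^esub> y \<in> carrier (G_group S)"
      unfolding carrier_G_group using dense_morphisms_comp[OF \<alpha>(1) \<beta>(1)] by (rule image_eqI)
    show "x \<otimes>\<^bsub>G_group S\<^esub> y = x \<otimes>\<^bsub>units_of (C_monoid S)\<^esub> y"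
      unfolding \<alpha>(2) \<beta>(2) units_of_mult by (rule mult_G_group[OF \<alpha>(1) \<beta>(1)])
  qed
  then have "id \<in> iso (units_of (C_monoid S)) (G_group S)"
    unfolding iso_def hom_def carrier by simp
  then show ?thesis
    unfolding is_iso_def by blast
qed

end

theorem proposition9p15:
  fixes S :: "('a, 'b) monoid_scheme"
    and d :: "'a \<Rightarrow> nat ^ 'k::finite"
  assumes "k_monoid S d"
    and "finitely_aligned S"
    and "\<And>i. finite (alphabet S d i)"
    and "\<And>i. card (alphabet S d i) \<ge> 2"
  shows "units_of (C_monoid S) \<cong> G_group S"
proof -
  interpret k_monoid S d
    by fact
  interpret right_cancellative_aligned_monoid S
    by unfold_locales (rule right_cancellative, assumption+, rule assms(2))
  show ?thesis
    by (rule units_of_C_monoid_iso_G_group)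
qed

end
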